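(* Let $k \ge 1$ and let $S = \{j_1 < j_2 < \cdots < j_k\}$ be a set of positive integers (the numbers of cookies in $k$ jars) such that for every $i$ with $1 \le i \le k$ one has $j_i > \sum_{m=1}^{i-1} j_m$. Then there is no way to empty all the jars in fewer moves than by emptying them one by one, i.e. $\mathrm{CM}(S) = k$.
   Context: A set $S = \{j_1 < j_2 < \cdots < j_k\}$ of distinct positive integers represents $k$ jars, where the $i$-th jar initially contains $j_i$ cookies. A move consists of choosing any subset of the jars and a positive integer $a$, such that every chosen jar currently contains at least $a$ cookies, and removing exactly $a$ cookies from each chosen jar (the same number from each). The Cookie Monster number $\mathrm{CM}(S)$ is the minimum number of moves needed to empty all of the jars. Emptying the jars one by one takes $k$ moves. An empty sum is $0$. *)

theory Defs
  imports Main
begin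

text \<open>
  The jars are named by their initial contents, which are distinct: for \<open>s \<in> S\<close>, the value \<open>c s\<close> is
  the number of cookies currently in the jar that started with \<open>s\<close> cookies. Hence the initial
  configuration is \<open>\<lambda>s. s\<close>. Values of \<open>c\<close> outside \<open>S\<close> are irrelevant and never change.
\<close>

definition cookie_move :: "nat set \<Rightarrow> (nat \<Rightarrow> nat) \<Rightarrow> (nat \<Rightarrow> nat) \<Rightarrow> bool" where
  "cookie_move S c c' \<longleftrightarrow>
    (\<exists>A a. A \<subseteq> S \<and> a > 0 \<and> (\<forall>s\<in>A. a \<le> c s) \<and>
      c' = (\<lambda>s. if s \<in> A then c s - a else c s))"

definition emptied_in :: "nat set \<Rightarrow> nat \<Rightarrow> bool" where
  "emptied_in S n \<longleftrightarrow>
    (\<exists>c. (cookie_move S ^^ n) (\<lambda>s. s) c \<and> (\<forall>s\<in>S. c s = 0))"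

text \<open>The minimum exists for finite \<open>S\<close>, since the jars can be emptied one by one.\<close>

definition CM :: "nat set \<Rightarrow> nat" where
  "CM S = (LEAST n. emptied_in S n)"

end

theory Submission
  imports Defs
begin

text \<open>
  Emptying the jars one by one gives \<open>CM S \<le> k\<close> (\<open>emptied_in_card\<close>). For the lower bound only the
  bookkeeping of a sequence of moves matters: after \<open>n\<close> moves that empty everything, the initial
  content of each jar is the sum of the amounts of those moves that touch the jar
  (\<open>moves_account\<close>). Each jar holds more than all smaller jars together. If every move touching a jar
  also touched a smaller one, the amounts removed from the smaller jars would add up to at least the
  content of the larger jar, which is too much. So each jar, in increasing order, is touched by some
  move that touches no smaller jar. These moves are pairwise distinct, hence there are at least \<open>k\<close>
  of them (\<open>superincreasing_card_UN_ge\<close>).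
\<close>

lemma sum_UN_le_sum_sum:
  fixes a :: "'t \<Rightarrow> nat"
  assumes "finite I" and "\<And>i. i \<in> I \<Longrightarrow> finite (T i)"
  shows "sum a (\<Union>i\<in>I. T i) \<le> (\<Sum>i\<in>I. sum a (T i))"
  using assms
proof (induction I rule: finite_induct)
  case empty
  show ?case by simp
next
  case (insert x I)
  have "sum a (T x \<union> (\<Union>i\<in>I. T i)) \<le> sum a (T x) + sum a (\<Union>i\<in>I. T i)"
    using insert.hyps insert.prems by (subst sum_Un_nat) auto
  with insert show ?case by fastforce
qed

text \<open>
  The sum over the union of the index sets is at most the sum of the separate sums, so
  superincrease forces every \<open>T (Suc k)\<close> to contain an index that lies in no earlier \<open>T i\<close>: the
  union grows at every step.
\<close>

lemma superincreasing_card_UN_ge: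
  fixes f :: "nat \<Rightarrow> nat" and a :: "'t \<Rightarrow> nat" and T :: "nat \<Rightarrow> 't set"
  assumes "\<And>i. i \<in> {1..k} \<Longrightarrow> finite (T i)"
    and "\<And>i. i \<in> {1..k} \<Longrightarrow> f i = sum a (T i)"
    and "\<And>i. i \<in> {1..k} \<Longrightarrow> f i > (\<Sum>m=1..<i. f m)"
  shows "k \<le> card (\<Union>i\<in>{1..k}. T i)"
  using assms
proof (induction k)
  case 0
  show ?case by simp
next
  case (Suc k)
  let ?U = "\<Union>i\<in>{1..k}. T i"
  have fin: "finite ?U" "finite (T (Suc k))"
    using Suc.prems(1) by auto
  have "\<not> T (Suc k) \<subseteq> ?U"
  proof
    assume "T (Suc k) \<subseteq> ?U"
    have "f (Suc k) = sum a (T (Suc k))"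
      using Suc.prems(2) by simp
    also have "\<dots> \<le> sum a ?U"
      using fin \<open>T (Suc k) \<subseteq> ?U\<close> by (intro sum_mono2) auto
    also have "\<dots> \<le> (\<Sum>i\<in>{1..k}. sum a (T i))"
      by (rule sum_UN_le_sum_sum) (use Suc.prems(1) in auto)
    also have "\<dots> = (\<Sum>m=1..<Suc k. f m)"
      by (rule sum.cong) (use Suc.prems(2) in auto)
    also have "\<dots> < f (Suc k)"
      using Suc.prems(3)[of "Suc k"] by simp
    finally show False by simp
  qed
  then have "?U \<subset> ?U \<union> T (Suc k)" by blast
  then have "card ?U < card (?U \<union> T (Suc k))"
    using fin by (intro psubset_card_mono) auto
  moreover have "k \<le> card ?U"
    using Suc.prems by (intro Suc.IH) auto
  moreover have "(\<Union>i\<in>{1..Suc k}. T i) = ?U \<union> T (Suc k)"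
    by (auto simp: atLeastAtMostSuc_conv)
  ultimately show ?case by simp
qed

text \<open>
  Subtraction on the natural numbers loses nothing here, because a move never takes more from a jar
  than the jar contains.
\<close>

lemma moves_account:
  assumes "(cookie_move S ^^ n) c c'"
  shows "\<exists>A a. \<forall>s. c s = c' s + sum a {t. t < n \<and> s \<in> A t}"
  using assms
proof (induction n arbitrary: c')
  case 0
  then show ?case by simp
next
  case (Suc n)
  then obtain d where d: "(cookie_move S ^^ n) c d" and "cookie_move S d c'"
    by (auto elim: relpowp_Suc_E)
  then obtain B b where le: "\<forall>s\<in>B. b \<le> d s"
    and c': "c' = (\<lambda>s. if s \<in> B then d s - b else d s)"
    unfolding cookie_move_def by blast
  obtain A a where Aa: "\<And>s. c s = d s + sum a {t. t < n \<and> s \<in> A t}"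
    using Suc.IH[OF d] by blast
  have "c s = c' s + sum (a(n := b)) {t. t < Suc n \<and> s \<in> (A(n := B)) t}" for s
  proof -
    have split: "{t. t < Suc n \<and> s \<in> (A(n := B)) t} =
        (if s \<in> B then {n} else {}) \<union> {t. t < n \<and> s \<in> A t}"
      by (auto simp: less_Suc_eq)
    have "sum (a(n := b)) {t. t < n \<and> s \<in> A t} = sum a {t. t < n \<and> s \<in> A t}"
      by (rule sum.cong) auto
    then show ?thesis
      unfolding split c' using le Aa[of s] by simp
  qed
  then show ?case by blast
qed

lemma emptied_in_card:
  assumes "finite S" and pos: "\<forall>s\<in>S. s > 0"
  shows "emptied_in S (card S)"
proof -
  have "(cookie_move S ^^ card R) (\<lambda>s. s) (\<lambda>s. if s \<in> R then 0 else s)" if "R \<subseteq> S" for R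
    using finite_subset[OF that \<open>finite S\<close>] that
  proof (induction R rule: finite_induct)
    case empty
    then show ?case by simp
  next
    case (insert x R)
    have "cookie_move S (\<lambda>s. if s \<in> R then 0 else s) (\<lambda>s. if s \<in> insert x R then 0 else s)"
      unfolding cookie_move_def
      using insert.hyps insert.prems pos by (intro exI[of _ "{x}"] exI[of _ x]) auto
    with insert show ?case
      by (auto intro: relpowp_Suc_I)
  qed
  from this[of S] show ?thesis
    unfolding emptied_in_def by (intro exI conjI) auto
qed

theorem theorem3:
  fixes k :: nat and j :: "nat \<Rightarrow> nat" and S :: "nat set"
  assumes "k \<ge> 1"
    and "S = j ` {1..k}"
    and "strict_mono_on {1..k} j"
    and "\<forall>i\<in>{1..k}. j i > 0"
    and "\<forall>i\<in>{1..k}. j i > (\<Sum>m=1..<i. j m)"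
  shows "CM S = k"
  unfolding CM_def
proof (rule Least_equality)
  have "card S = k"
    using assms(2,3) by (simp add: card_image strict_mono_on_imp_inj_on)
  then show "emptied_in S k"
    using emptied_in_card[of S] assms(2,4) by auto
next
  fix n
  assume "emptied_in S n"
  then obtain c where "(cookie_move S ^^ n) (\<lambda>s. s) c" and zero: "\<forall>s\<in>S. c s = 0"
    unfolding emptied_in_def by blast
  then obtain A a where Aa: "\<And>s. s = c s + sum a {t. t < n \<and> s \<in> A t}"
    using moves_account by meson
  let ?T = "\<lambda>i. {t. t < n \<and> j i \<in> A t}"
  have "k \<le> card (\<Union>i\<in>{1..k}. ?T i)"
  proof (rule superincreasing_card_UN_ge)
    fix i assume "i \<in> {1..k}"
    then show "j i = sum a (?T i)"
      using Aa[of "j i"] zero assms(2) by simp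
    show "j i > (\<Sum>m=1..<i. j m)"
      using assms(5) \<open>i \<in> {1..k}\<close> by blast
  qed simp
  also have "\<dots> \<le> card {..<n}"
    by (intro card_mono) auto
  finally show "k \<le> n" by simp
qed

end
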